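(* Let $S$ be an $E$-Ehresmann semigroup and let $C=\mathbf{C}(S)$ be the corresponding Ehresmann category. Then $C$ is an EI-category if and only if, for $a\in S$, $a^+=a^\ast$ implies that $a$ is a group element. In other words, $C$ is an EI-category if and only if the $\widetilde{\mathcal{H}}_E$-class of $e$ equals its $\mathcal{H}$-class for every $e\in E$.
   Context: Let $S$ be a semigroup and $E\subseteq E(S)$ a subsemilattice (a subsemigroup of commuting idempotents), where $E(S)$ is the set of idempotents of $S$. Define $a\,\widetilde{\mathcal{R}}_E\,b$ iff for all $e\in E$ ($ea=a\Leftrightarrow eb=b$), and $a\,\widetilde{\mathcal{L}}_E\,b$ iff for all $e\in E$ ($ae=a\Leftrightarrow be=b$); put $\widetilde{\mathcal{H}}_E=\widetilde{\mathcal{R}}_E\cap\widetilde{\mathcal{L}}_E$. $S$ is $E$-Ehresmann if every $\widetilde{\mathcal{R}}_E$-class and every $\widetilde{\mathcal{L}}_E$-class contains precisely one element of $E$, $\widetilde{\mathcal{R}}_E$ is a left congruence and $\widetilde{\mathcal{L}}_E$ is a right congruence. The element of $E$ in the $\widetilde{\mathcal{R}}_E$-class (resp. $\widetilde{\mathcal{L}}_E$-class) of $a$ is denoted $a^+$ (resp. $a^\ast$). The category $\mathbf{C}(S)=C$: its object set is $E$; its morphisms are in bijection with $S$, the morphism corresponding to $a\in S$ being denoted $C(a)$, with domain $a^+$ and range $a^\ast$. Morphisms are composed from left to right: $C(a)\cdot C(b)$ is defined iff $a^\ast=b^+$, and then $C(a)\cdot C(b)=C(ab)$. The identity morphism at $e\in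 E$ is $C(e)$. (As an Ehresmann category, $C$ also carries two partial orders, $C(a)\leq_r C(b)$ iff $a=a^+b$ and $C(a)\leq_l C(b)$ iff $a=ba^\ast$; they play no role in this statement.) $\mathcal{H}$ is Green's relation on $S$. A group element of a semigroup is an element lying in a subgroup of the semigroup. An EI-category is a category in which every endomorphism is an isomorphism.
   Formalization: "Group element" is read as an element of a subgroup of S whose identity lies in E; with arbitrary subgroups the first equivalence fails, e.g. for the multiplicative semigroup of a field with E = {1}, where 0 lies in the subgroup {0} but is a non-invertible endomorphism. *)

theory Defs
  imports Main "HOL-Algebra.Group"
begin

text \<open>
  Composition is written from left to right. It is a total function on the type of morphisms
  that is only meaningful at pairs \<open>x, y\<close> with \<open>Cod C x = Dom C y\<close>; no definition below
  looks at its other values.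
\<close>

record ('o, 'm) cat =
  Obj :: "'o set"
  Mor :: "'m set"
  Dom :: "'m \<Rightarrow> 'o"
  Cod :: "'m \<Rightarrow> 'o"
  Comp :: "'m \<Rightarrow> 'm \<Rightarrow> 'm"
  Ident :: "'o \<Rightarrow> 'm"

definition category :: "('o, 'm) cat \<Rightarrow> bool" where
  "category C \<longleftrightarrow>
     (\<forall>x\<in>Mor C. Dom C x \<in> Obj C \<and> Cod C x \<in> Obj C) \<and>
     (\<forall>u\<in>Obj C. Ident C u \<in> Mor C \<and> Dom C (Ident C u) = u \<and> Cod C (Ident C u) = u) \<and>
     (\<forall>x\<in>Mor C. \<forall>y\<in>Mor C. Cod C x = Dom C y \<longrightarrow>
        Comp C x y \<in> Mor C \<and> Dom C (Comp C x y) = Dom C x \<and> Cod C (Comp C x y) = Cod C y) \<and>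
     (\<forall>x\<in>Mor C. Comp C (Ident C (Dom C x)) x = x \<and> Comp C x (Ident C (Cod C x)) = x) \<and>
     (\<forall>x\<in>Mor C. \<forall>y\<in>Mor C. \<forall>z\<in>Mor C. Cod C x = Dom C y \<longrightarrow> Cod C y = Dom C z \<longrightarrow>
        Comp C (Comp C x y) z = Comp C x (Comp C y z))"

definition endomorphism :: "('o, 'm) cat \<Rightarrow> 'm \<Rightarrow> bool" where
  "endomorphism C x \<longleftrightarrow> x \<in> Mor C \<and> Dom C x = Cod C x"

definition isomorphism :: "('o, 'm) cat \<Rightarrow> 'm \<Rightarrow> bool" where
  "isomorphism C x \<longleftrightarrow> x \<in> Mor C \<and>
     (\<exists>y\<in>Mor C. Dom C y = Cod C x \<and> Cod C y = Dom C x \<and>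
        Comp C x y = Ident C (Dom C x) \<and> Comp C y x = Ident C (Cod C x))"

definition EI_category :: "('o, 'm) cat \<Rightarrow> bool" where
  "EI_category C \<longleftrightarrow> category C \<and> (\<forall>x. endomorphism C x \<longrightarrow> isomorphism C x)"

text \<open>
  The semigroup is the whole of a type of class \<^class>\<open>semigroup_mult\<close>.
\<close>

definition subsemilattice :: "'a::semigroup_mult set \<Rightarrow> bool" where
  "subsemilattice E \<longleftrightarrow>
     (\<forall>e\<in>E. e * e = e) \<and> (\<forall>e\<in>E. \<forall>f\<in>E. e * f \<in> E) \<and> (\<forall>e\<in>E. \<forall>f\<in>E. e * f = f * e)"

definition R_tilde :: "'a::semigroup_mult set \<Rightarrow> 'a rel" where
  "R_tilde E = {(a, b). \<forall>e\<in>E. e * a = a \<longleftrightarrow> e * b = b}"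

definition L_tilde :: "'a::semigroup_mult set \<Rightarrow> 'a rel" where
  "L_tilde E = {(a, b). \<forall>e\<in>E. a * e = a \<longleftrightarrow> b * e = b}"

definition H_tilde :: "'a::semigroup_mult set \<Rightarrow> 'a rel" where
  "H_tilde E = R_tilde E \<inter> L_tilde E"

definition left_congruence :: "'a::semigroup_mult rel \<Rightarrow> bool" where
  "left_congruence r \<longleftrightarrow> equiv UNIV r \<and> (\<forall>a b c. (a, b) \<in> r \<longrightarrow> (c * a, c * b) \<in> r)"

definition right_congruence :: "'a::semigroup_mult rel \<Rightarrow> bool" where
  "right_congruence r \<longleftrightarrow> equiv UNIV r \<and> (\<forall>a b c. (a, b) \<in> r \<longrightarrow> (a * c, b * c) \<in> r)"

definition Ehresmann :: "'a::semigroup_mult set \<Rightarrow> bool" where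
  "Ehresmann E \<longleftrightarrow> subsemilattice E \<and>
     (\<forall>X \<in> UNIV // R_tilde E. \<exists>!e. e \<in> X \<inter> E) \<and>
     (\<forall>X \<in> UNIV // L_tilde E. \<exists>!e. e \<in> X \<inter> E) \<and>
     left_congruence (R_tilde E) \<and> right_congruence (L_tilde E)"

definition plus_elt :: "'a::semigroup_mult set \<Rightarrow> 'a \<Rightarrow> 'a" where
  "plus_elt E a = (THE e. e \<in> R_tilde E `` {a} \<inter> E)"

definition star_elt :: "'a::semigroup_mult set \<Rightarrow> 'a \<Rightarrow> 'a" where
  "star_elt E a = (THE e. e \<in> L_tilde E `` {a} \<inter> E)"

text \<open>The morphism usually written \<open>C(a)\<close> is represented by \<open>a\<close> itself.\<close>

definition Ehresmann_cat :: "'a::semigroup_mult set \<Rightarrow> ('a, 'a) cat" where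
  "Ehresmann_cat E =
     \<lparr>Obj = E, Mor = UNIV, Dom = plus_elt E, Cod = star_elt E, Comp = (*), Ident = (\<lambda>e. e)\<rparr>"

text \<open>The principal one-sided ideals \<open>aS\<^sup>1\<close> and \<open>S\<^sup>1a\<close>.\<close>

definition right_ideal :: "'a::semigroup_mult \<Rightarrow> 'a set" where
  "right_ideal a = insert a {a * x | x. True}"

definition left_ideal :: "'a::semigroup_mult \<Rightarrow> 'a set" where
  "left_ideal a = insert a {x * a | x. True}"

definition Green_R :: "'a::semigroup_mult rel" where
  "Green_R = {(a, b). right_ideal a = right_ideal b}"

definition Green_L :: "'a::semigroup_mult rel" where
  "Green_L = {(a, b). left_ideal a = left_ideal b}"

definition Green_H :: "'a::semigroup_mult rel" where
  "Green_H = Green_R \<inter> Green_L"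

definition subgroup_at :: "'a::semigroup_mult set \<Rightarrow> 'a \<Rightarrow> bool" where
  "subgroup_at G f \<longleftrightarrow> group \<lparr>carrier = G, monoid.mult = (*), one = f\<rparr>"

text \<open>
  Relative to \<open>E\<close>, a group element is one lying in a subgroup whose identity is a distinguished
  idempotent, i.e. belongs to \<open>E\<close>. Without the condition \<open>f \<in> E\<close> the characterisation of
  EI-categories by group elements is false: in the multiplicative semigroup of a field with
  \<open>E = {1}\<close> every element, including 0, lies in some subgroup and has \<open>a\<^sup>+ = 1 = a\<^sup>*\<close>,
  but 0 is a non-invertible endomorphism of the single object 1.
\<close>

definition group_element :: "'a::semigroup_mult set \<Rightarrow> 'a \<Rightarrow> bool" where
  "group_element E a \<longleftrightarrow> (\<exists>G f. subgroup_at G f \<and> f \<in> E \<and> a \<in> G)"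

lemma equiv_R_tilde: "equiv UNIV (R_tilde E)"
  by (auto simp: R_tilde_def intro!: equivI refl_onI symI transI)

lemma equiv_L_tilde: "equiv UNIV (L_tilde E)"
  by (auto simp: L_tilde_def intro!: equivI refl_onI symI transI)

lemma ex1_plus_elt:
  assumes "Ehresmann E"
  shows "\<exists>!e. e \<in> R_tilde E `` {a} \<inter> E"
proof -
  have "R_tilde E `` {a} \<in> UNIV // R_tilde E" by (rule quotientI) simp
  moreover have "\<forall>X \<in> UNIV // R_tilde E. \<exists>!e. e \<in> X \<inter> E"
    using assms unfolding Ehresmann_def by (elim conjE)
  ultimately show ?thesis by (rule bspec[rotated])
qed

lemma ex1_star_elt:
  assumes "Ehresmann E"
  shows "\<exists>!e. e \<in> L_tilde E `` {a} \<inter> E"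
proof -
  have "L_tilde E `` {a} \<in> UNIV // L_tilde E" by (rule quotientI) simp
  moreover have "\<forall>X \<in> UNIV // L_tilde E. \<exists>!e. e \<in> X \<inter> E"
    using assms unfolding Ehresmann_def by (elim conjE)
  ultimately show ?thesis by (rule bspec[rotated])
qed

lemma Ehresmann_idem: "Ehresmann E \<Longrightarrow> e \<in> E \<Longrightarrow> e * e = e"
  unfolding Ehresmann_def subsemilattice_def by (elim conjE) (rule bspec)

lemma plus_elt:
  assumes "Ehresmann E"
  shows "plus_elt E a \<in> E" "(a, plus_elt E a) \<in> R_tilde E" "plus_elt E a * a = a"
proof -
  have "plus_elt E a \<in> R_tilde E `` {a} \<inter> E"
    unfolding plus_elt_def by (rule theI'[OF ex1_plus_elt[OF assms]])
  then show *: "plus_elt E a \<in> E" "(a, plus_elt E a) \<in> R_tilde E" by simp_all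
  from * show "plus_elt E a * a = a"
    using Ehresmann_idem[OF assms *(1)] by (simp add: R_tilde_def)
qed

lemma star_elt:
  assumes "Ehresmann E"
  shows "star_elt E a \<in> E" "(a, star_elt E a) \<in> L_tilde E" "a * star_elt E a = a"
proof -
  have "star_elt E a \<in> L_tilde E `` {a} \<inter> E"
    unfolding star_elt_def by (rule theI'[OF ex1_star_elt[OF assms]])
  then show *: "star_elt E a \<in> E" "(a, star_elt E a) \<in> L_tilde E" by simp_all
  from * show "a * star_elt E a = a"
    using Ehresmann_idem[OF assms *(1)] by (simp add: L_tilde_def)
qed

lemma plus_elt_eqI:
  assumes "Ehresmann E" "e \<in> E" "(a, e) \<in> R_tilde E"
  shows "plus_elt E a = e"
  unfolding plus_elt_def
  by (rule the1_equality[OF ex1_plus_elt[OF assms(1)]]) (simp add: assms)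

lemma star_elt_eqI:
  assumes "Ehresmann E" "e \<in> E" "(a, e) \<in> L_tilde E"
  shows "star_elt E a = e"
  unfolding star_elt_def
  by (rule the1_equality[OF ex1_star_elt[OF assms(1)]]) (simp add: assms)

lemma plus_elt_self: "Ehresmann E \<Longrightarrow> e \<in> E \<Longrightarrow> plus_elt E e = e"
  by (rule plus_elt_eqI) (simp_all add: R_tilde_def)

lemma star_elt_self: "Ehresmann E \<Longrightarrow> e \<in> E \<Longrightarrow> star_elt E e = e"
  by (rule star_elt_eqI) (simp_all add: L_tilde_def)

lemma plus_elt_mult:
  assumes E: "Ehresmann E" and ab: "star_elt E a = plus_elt E b"
  shows "plus_elt E (a * b) = plus_elt E a"
proof -
  have "left_congruence (R_tilde E)" using E unfolding Ehresmann_def by (elim conjE)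
  then have "(a * b, a * plus_elt E b) \<in> R_tilde E"
    using plus_elt(2)[OF E, of b] by (simp add: left_congruence_def)
  also have "a * plus_elt E b = a" unfolding ab[symmetric] by (rule star_elt(3)[OF E])
  finally have "(a * b, plus_elt E a) \<in> R_tilde E"
    using plus_elt(2)[OF E, of a] by (simp add: R_tilde_def)
  then show ?thesis by (rule plus_elt_eqI[OF E plus_elt(1)[OF E]])
qed

lemma star_elt_mult:
  assumes E: "Ehresmann E" and ab: "star_elt E a = plus_elt E b"
  shows "star_elt E (a * b) = star_elt E b"
proof -
  have "right_congruence (L_tilde E)" using E unfolding Ehresmann_def by (elim conjE)
  then have "(a * b, star_elt E a * b) \<in> L_tilde E"
    using star_elt(2)[OF E, of a] by (simp add: right_congruence_def)
  also have "star_elt E a * b = b" unfolding ab by (rule plus_elt(3)[OF E])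
  finally have "(a * b, star_elt E b) \<in> L_tilde E"
    using star_elt(2)[OF E, of b] by (simp add: L_tilde_def)
  then show ?thesis by (rule star_elt_eqI[OF E star_elt(1)[OF E]])
qed

lemma category_Ehresmann_cat:
  assumes E: "Ehresmann E"
  shows "category (Ehresmann_cat E)"
  unfolding category_def Ehresmann_cat_def
  by (simp add: plus_elt(1,3)[OF E] star_elt(1,3)[OF E] plus_elt_self[OF E] star_elt_self[OF E]
      plus_elt_mult[OF E] star_elt_mult[OF E] mult.assoc)

end

theory Submission imports Defs begin

text \<open>
  All three conditions say that every \<open>a\<close> with \<open>a\<^sup>+ = a\<^sup>* = e\<close> is a unit of the monoid \<open>eSe\<close>:
  the units of \<open>eSe\<close> form the largest subgroup with identity \<open>e\<close>, they form the \<open>\<H>\<close>-class of \<open>e\<close>,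
  and they are exactly the isomorphisms of \<open>\<^bold>C(S)\<close> from \<open>e\<close> to \<open>e\<close>.
\<close>

definition local_units :: "'a::semigroup_mult \<Rightarrow> 'a set" where
  "local_units e = {a. e * a = a \<and> a * e = a \<and>
     (\<exists>b. e * b = b \<and> b * e = b \<and> a * b = e \<and> b * a = e)}"

lemma local_unitsI:
  "e * a = a \<Longrightarrow> a * e = a \<Longrightarrow> e * b = b \<Longrightarrow> b * e = b \<Longrightarrow> a * b = e \<Longrightarrow> b * a = e \<Longrightarrow>
    a \<in> local_units e"
  unfolding local_units_def by blast

text \<open>The condition is symmetric in \<open>a\<close> and \<open>b\<close>, so the inverse is
  again a unit; closure under inverses comes from this.\<close>

lemma local_unitsE:
  assumes "a \<in> local_units e"
  obtains b where "b \<in> local_units e" "e * a = a" "a * e = a" "e * b = b" "b * e = b"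
    "a * b = e" "b * a = e"
  using assms unfolding local_units_def by blast

lemma local_units_mult:
  assumes "a \<in> local_units e" "b \<in> local_units e"
  shows "a * b \<in> local_units e"
proof -
  obtain a' where a: "e * a = a" "a * e = a" "e * a' = a'" "a' * e = a'" "a * a' = e" "a' * a = e"
    using assms(1) by (rule local_unitsE)
  obtain b' where b: "e * b = b" "b * e = b" "e * b' = b'" "b' * e = b'" "b * b' = e" "b' * b = e"
    using assms(2) by (rule local_unitsE)
  show ?thesis
  proof (rule local_unitsI[where b = "b' * a'"])
    have "a * b * (b' * a') = a * (b * b') * a'" by (simp only: mult.assoc)
    then show "a * b * (b' * a') = e" by (simp add: a b)
    have "b' * a' * (a * b) = b' * (a' * a) * b" by (simp only: mult.assoc)
    then show "b' * a' * (a * b) = e" by (simp add: a b)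
    show "e * (a * b) = a * b" "e * (b' * a') = b' * a'"
      by (simp_all add: a b flip: mult.assoc)
    show "a * b * e = a * b" "b' * a' * e = b' * a'"
      by (simp_all add: a b mult.assoc)
  qed
qed

lemma subgroup_at_local_units:
  assumes "e * e = e"
  shows "subgroup_at (local_units e) e"
  unfolding subgroup_at_def
proof (rule groupI, goal_cases)
  case (1 x y)
  then show ?case by (simp add: local_units_mult)
next
  case 2
  show ?case using assms by (simp add: local_unitsI[of e e e])
next
  case (3 x y z)
  then show ?case by (simp add: mult.assoc)
next
  case (4 x)
  then show ?case by (auto elim: local_unitsE)
next
  case (5 x)
  then show ?case by (auto elim: local_unitsE)
qed

lemma subgroup_at_subset_local_units:
  assumes "subgroup_at G e"
  shows "G \<subseteq> local_units e"
proof
  fix a assume a: "a \<in> G"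
  interpret group "\<lparr>carrier = G, monoid.mult = (*), one = e\<rparr>"
    using assms unfolding subgroup_at_def .
  let ?b = "inv\<^bsub>\<lparr>carrier = G, monoid.mult = (*), one = e\<rparr>\<^esub> a"
  have b: "?b \<in> G" using inv_closed[of a] a by simp
  show "a \<in> local_units e"
    using l_one[of a] r_one[of a] l_one[of ?b] r_one[of ?b] l_inv[of a] r_inv[of a] a b
    by (auto intro!: local_unitsI[where b = ?b])
qed

text \<open>For each \<open>e\<close> there is a largest subgroup with identity \<open>e\<close>, so
  the quantifier over \<open>G\<close> disappears.\<close>

lemma group_element_iff:
  assumes "Ehresmann E"
  shows "group_element E a \<longleftrightarrow> (\<exists>e\<in>E. a \<in> local_units e)"
  using subgroup_at_local_units[OF Ehresmann_idem[OF assms]] subgroup_at_subset_local_units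
  unfolding group_element_def by blast

text \<open>The relation R with \<open>e\<close> makes \<open>e\<close> a left identity for
  \<open>a\<close> and gives a right inverse of \<open>a\<close>; the relation L gives the mirror
  images.\<close>

lemma Green_H_idem:
  fixes e :: "'a::semigroup_mult"
  assumes e: "e * e = e"
  shows "Green_H `` {e} = local_units e"
proof (intro Set.set_eqI iffI)
  fix a assume "a \<in> Green_H `` {e}"
  then have R: "right_ideal e = right_ideal a" and L: "left_ideal e = left_ideal a"
    by (auto simp: Green_H_def Green_R_def Green_L_def)
  have "a \<in> right_ideal e" unfolding R by (simp add: right_ideal_def)
  then have ea: "e * a = a" using e by (auto simp: right_ideal_def simp flip: mult.assoc)
  have "a \<in> left_ideal e" unfolding L by (simp add: left_ideal_def)
  then have ae: "a * e = a" using e by (auto simp: left_ideal_def mult.assoc)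
  have "e \<in> right_ideal a" "e \<in> left_ideal a"
    unfolding R[symmetric] L[symmetric] by (simp_all add: right_ideal_def left_ideal_def)
  \<comment> \<open>If \<open>e\<close> is in an ideal only as its adjoined generator, then
    \<open>a = e\<close>, and \<open>e\<close> itself serves as \<open>x\<close> or \<open>y\<close>
    by idempotency.\<close>
  then obtain x y where x: "a * x = e" and y: "y * a = e"
    using e unfolding right_ideal_def left_ideal_def by auto
  \<comment> \<open>The factors \<open>x\<close> and \<open>y\<close> may lie outside eSe;
    multiplying by \<open>e\<close> on both sides moves them inside and keeps them one-sided
    inverses.\<close>
  define b where "b = e * x * e"
  define c where "c = e * y * e"
  have ab: "a * b = e"
    unfolding b_def by (simp add: ae x e flip: mult.assoc)
  have ca: "c * a = e"
    unfolding c_def by (simp add: ea y e mult.assoc)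
  have eb: "e * b = b" and be: "b * e = b" and ce: "c * e = c"
    unfolding b_def c_def by (simp_all add: e mult.assoc) (simp add: e flip: mult.assoc)
  \<comment> \<open>A left and a right inverse in the monoid eSe coincide.\<close>
  have "c = c * (a * b)" by (simp add: ab ce)
  also have "\<dots> = b" by (simp add: ca eb flip: mult.assoc)
  finally show "a \<in> local_units e"
    using ea ae eb be ab ca by (auto intro: local_unitsI)
next
  fix a assume "a \<in> local_units e"
  then obtain b where a: "e * a = a" "a * e = a" "a * b = e" "b * a = e"
    by (rule local_unitsE)
  \<comment> \<open>Each equation rewrites a multiple of one generator as a multiple of the other,
    one for each of the four inclusions of ideals.\<close>
  have R: "a * x = e * (a * x)" "e * x = a * (b * x)"
    and L: "x * a = x * a * e" "x * e = x * b * a" for x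
    by (simp_all add: a mult.assoc) (simp_all add: a flip: mult.assoc)
  have "right_ideal e = right_ideal a"
    unfolding right_ideal_def using a(1,3) R by (auto intro: sym)
  moreover have "left_ideal e = left_ideal a"
    unfolding left_ideal_def using a(2,4) L by (auto intro: sym)
  ultimately show "a \<in> Green_H `` {e}"
    by (simp add: Green_H_def Green_R_def Green_L_def)
qed

text \<open>This identifies the class with the endomorphisms of the object \<open>e\<close>.\<close>

lemma H_tilde_class:
  assumes E: "Ehresmann E" and e: "e \<in> E"
  shows "H_tilde E `` {e} = {a. plus_elt E a = e \<and> star_elt E a = e}"
proof (intro Set.set_eqI iffI)
  fix a assume "a \<in> H_tilde E `` {e}"
  then have "(a, e) \<in> R_tilde E" "(a, e) \<in> L_tilde E"
    by (simp_all add: H_tilde_def R_tilde_def L_tilde_def)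
  then show "a \<in> {a. plus_elt E a = e \<and> star_elt E a = e}"
    using plus_elt_eqI[OF E e] star_elt_eqI[OF E e] by simp
next
  fix a assume "a \<in> {a. plus_elt E a = e \<and> star_elt E a = e}"
  then show "a \<in> H_tilde E `` {e}"
    using plus_elt(2)[OF E, of a] star_elt(2)[OF E, of a]
    by (simp add: H_tilde_def R_tilde_def L_tilde_def)
qed

text \<open>Right multiplication by the inverse turns \<open>f * a = a\<close> into
  \<open>f * e = e\<close>, and right multiplication by \<open>a\<close> turns it back.\<close>

lemma plus_elt_local_unit:
  assumes E: "Ehresmann E" and e: "e \<in> E" and a: "a \<in> local_units e"
  shows "plus_elt E a = e"
proof (rule plus_elt_eqI[OF E e])
  obtain b where b: "e * a = a" "a * b = e" using a by (rule local_unitsE)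
  have "f * a = a \<longleftrightarrow> f * e = e" for f
    using b by (metis mult.assoc)
  then show "(a, e) \<in> R_tilde E" by (simp add: R_tilde_def)
qed

lemma star_elt_local_unit:
  assumes E: "Ehresmann E" and e: "e \<in> E" and a: "a \<in> local_units e"
  shows "star_elt E a = e"
proof (rule star_elt_eqI[OF E e])
  obtain b where b: "a * e = a" "b * a = e" using a by (rule local_unitsE)
  have "a * f = a \<longleftrightarrow> e * f = e" for f
    using b by (metis mult.assoc)
  then show "(a, e) \<in> L_tilde E" by (simp add: L_tilde_def)
qed

lemma isomorphism_Ehresmann_cat_iff:
  assumes E: "Ehresmann E" and a: "plus_elt E a = e" "star_elt E a = e"
  shows "isomorphism (Ehresmann_cat E) a \<longleftrightarrow> a \<in> local_units e"
proof
  assume "isomorphism (Ehresmann_cat E) a"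
  then obtain b where "plus_elt E b = e" "star_elt E b = e" "a * b = e" "b * a = e"
    using a by (auto simp: isomorphism_def Ehresmann_cat_def)
  then show "a \<in> local_units e"
    using plus_elt(3)[OF E] star_elt(3)[OF E] a by (metis local_unitsI)
next
  assume "a \<in> local_units e"
  then obtain b where b: "b \<in> local_units e" "a * b = e" "b * a = e"
    by (rule local_unitsE)
  \<comment> \<open>Being \<open>plus_elt E a\<close>, \<open>e\<close> lies in \<open>E\<close>, so
    the inverse, itself a unit at \<open>e\<close>, has domain and range \<open>e\<close> and is a
    morphism of the required type.\<close>
  have "e \<in> E" using plus_elt(1)[OF E, of a] a by simp
  then have "plus_elt E b = e" "star_elt E b = e"
    using b(1) plus_elt_local_unit[OF E] star_elt_local_unit[OF E] by blast+
  then show "isomorphism (Ehresmann_cat E) a"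
    using a b by (auto simp: isomorphism_def Ehresmann_cat_def)
qed

lemma EI_Ehresmann_cat_iff:
  assumes E: "Ehresmann E"
  shows "EI_category (Ehresmann_cat E) \<longleftrightarrow>
    (\<forall>a. plus_elt E a = star_elt E a \<longrightarrow> a \<in> local_units (star_elt E a))"
proof -
  have "endomorphism (Ehresmann_cat E) a \<longleftrightarrow> plus_elt E a = star_elt E a" for a
    by (simp add: endomorphism_def Ehresmann_cat_def)
  then show ?thesis
    using isomorphism_Ehresmann_cat_iff[OF E] category_Ehresmann_cat[OF E]
    by (auto simp: EI_category_def)
qed

theorem corollary5p6:
  fixes E :: "'a::semigroup_mult set"
  assumes "Ehresmann E"
  shows "(EI_category (Ehresmann_cat E) \<longleftrightarrow>
            (\<forall>a. plus_elt E a = star_elt E a \<longrightarrow> group_element E a)) \<and>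
         (EI_category (Ehresmann_cat E) \<longleftrightarrow>
            (\<forall>e\<in>E. H_tilde E `` {e} = Green_H `` {e}))"
proof
  \<comment> \<open>A unit at some \<open>e\<close> in \<open>E\<close> has
    \<open>star_elt E a = e\<close>, so that idempotent is determined by \<open>a\<close>.\<close>
  have "group_element E a \<longleftrightarrow> a \<in> local_units (star_elt E a)" for a
    using group_element_iff[OF assms] star_elt_local_unit[OF assms] star_elt(1)[OF assms] by metis
  then show "EI_category (Ehresmann_cat E) \<longleftrightarrow>
      (\<forall>a. plus_elt E a = star_elt E a \<longrightarrow> group_element E a)"
    by (simp add: EI_Ehresmann_cat_iff[OF assms])
  \<comment> \<open>Units at \<open>e\<close> always lie in the \<open>H_tilde\<close> class of
    \<open>e\<close>, so equality amounts to the reverse inclusion.\<close>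
  have "H_tilde E `` {e} = Green_H `` {e} \<longleftrightarrow>
      (\<forall>a. plus_elt E a = e \<longrightarrow> star_elt E a = e \<longrightarrow> a \<in> local_units e)" if "e \<in> E" for e
    using that plus_elt_local_unit[OF assms that] star_elt_local_unit[OF assms that]
    by (auto simp: H_tilde_class[OF assms] Green_H_idem Ehresmann_idem[OF assms])
  then show "EI_category (Ehresmann_cat E) \<longleftrightarrow>
      (\<forall>e\<in>E. H_tilde E `` {e} = Green_H `` {e})"
    using star_elt(1)[OF assms] unfolding EI_Ehresmann_cat_iff[OF assms] by metis
qed

end
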